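(* If $A$ and $B$ are isoclinic skew left braces, then the commutator subgroups $\Lambda_{A^{\mathrm{op}}}'$ and $\Lambda_{B^{\mathrm{op}}}'$ of the groups $\Lambda_{A^{\mathrm{op}}}$ and $\Lambda_{B^{\mathrm{op}}}$ are isomorphic groups.
   Context: A skew left brace is a triple $(A,\cdot,\circ)$ where $(A,\cdot)$ and $(A,\circ)$ are groups with $a\circ(b\cdot c)=(a\circ b)\cdot a^{-1}\cdot(a\circ c)$ for all $a,b,c\in A$, where $a^{-1}$ is the inverse in $(A,\cdot)$. We write $ab=a\cdot b$; the two groups share the identity $1$. The map $\lambda:(A,\circ)\to\mathrm{Aut}(A,\cdot)$, $\lambda_a(b)=a^{-1}(a\circ b)$, is a group homomorphism, and so is $\lambda^{\mathrm{op}}:(A,\circ)\to\mathrm{Aut}(A,\cdot)$, $\lambda^{\mathrm{op}}_a(b)=(a\circ b)a^{-1}=a\lambda_a(b)a^{-1}$. The group $\Lambda_{A^{\mathrm{op}}}=(A,\cdot)\rtimes_{\lambda^{\mathrm{op}}}(A,\circ)$ is the set $A\times A$ with product $(a_1,b_1)(a_2,b_2)=(a_1\lambda^{\mathrm{op}}_{b_1}(a_2),\,b_1\circ b_2)$. An ideal of $A$ is a subset $I$ that is a normal subgroup of both $(A,\cdot)$ and $(A,\circ)$ with $\lambda_a(I)\subseteq I$ for all $a\in A$; then $A/I$ is a skew left brace. The annihilator is the ideal $\mathrm{Ann}(A)=\mathrm{Ker}(\lambda)\cap \mathrm{Z}(A,\cdot)\cap \mathrm{Z}(A,\circ)$, where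 $\mathrm{Z}$ denotes the center. The commutator $A'$ of the skew left brace $A$ is the subgroup of $(A,\cdot)$ generated by all elements $aba^{-1}b^{-1}$ and $a\lambda_b(a^{-1})$ with $a,b\in A$; it is an ideal, hence itself a skew left brace. Two skew left braces $A,B$ are isoclinic if there are skew left brace isomorphisms $\xi_1:A/\mathrm{Ann}(A)\to B/\mathrm{Ann}(B)$ and $\xi_2:A'\to B'$ such that $\xi_2\circ\theta_A=\theta_B\circ(\xi_1\times\xi_1)$ and $\xi_2\circ\theta_A^*=\theta_B^*\circ(\xi_1\times\xi_1)$, where $\theta_A,\theta_A^*:(A/\mathrm{Ann}(A))\times (A/\mathrm{Ann}(A))\to A'$ are the well-defined maps $\theta_A(\overline a,\overline b)=aba^{-1}b^{-1}$ and $\theta_A^*(\overline a,\overline b)=\lambda_a(b)b^{-1}$, and $\theta_B,\theta_B^*$ are defined similarly. *)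

theory Defs
  imports "HOL-Algebra.Bij" "HOL-Algebra.Generated_Groups"
begin

section \<open>Skew left braces\<close>

text \<open>
  The underlying \<^const>\<open>carrier\<close>, \<^const>\<open>mult\<close> and \<^const>\<open>one\<close> form the group $(A,\cdot)$; the
  record therefore serves as $(A,\cdot)$ itself. Both groups use the same unit field; this is no
  restriction, see \<open>circ_unit_eq_one\<close> below.
\<close>

record 'a skew_brace = "'a monoid" +
  circ :: "'a \<Rightarrow> 'a \<Rightarrow> 'a" (infixl \<open>\<star>\<index>\<close> 70)

definition circ_group :: "('a, 'm) skew_brace_scheme \<Rightarrow> 'a monoid" where
  "circ_group A = \<lparr>carrier = carrier A, mult = circ A, one = one A\<rparr>"

locale skew_left_brace = group A + circ: group "circ_group A"
  for A :: "('a, 'm) skew_brace_scheme" (structure) +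
  assumes brace_distrib:
    "\<lbrakk>a \<in> carrier A; b \<in> carrier A; c \<in> carrier A\<rbrakk>
      \<Longrightarrow> a \<star> (b \<otimes> c) = (a \<star> b) \<otimes> inv a \<otimes> (a \<star> c)"

lemma circ_unit_eq_one:
  fixes A :: "('a, 'm) skew_brace_scheme" (structure)
  assumes "group A" and "group \<lparr>carrier = carrier A, mult = circ A, one = e\<rparr>"
    and "\<And>a b c. \<lbrakk>a \<in> carrier A; b \<in> carrier A; c \<in> carrier A\<rbrakk>
      \<Longrightarrow> a \<star> (b \<otimes> c) = (a \<star> b) \<otimes> inv a \<otimes> (a \<star> c)"
  shows "e = \<one>"
proof -
  interpret group A by fact
  interpret C: group "\<lparr>carrier = carrier A, mult = circ A, one = e\<rparr>" by fact
  have e: "e \<in> carrier A" using C.one_closed by simp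
  have u: "e \<star> \<one> = \<one>" using C.l_one[of \<one>] by simp
  have "\<one> = inv e" using assms(3)[of e \<one> \<one>] e u by simp
  then show ?thesis using e by (metis inv_inv inv_one)
qed

text \<open>
  The maps $\lambda_a$ and $\lambda^{\mathrm{op}}_a$ are restricted to the carrier so that they are
  elements of \<^const>\<open>AutoGroup\<close>, whose members are extensional functions.
\<close>

definition brace_lambda :: "('a, 'm) skew_brace_scheme \<Rightarrow> 'a \<Rightarrow> 'a \<Rightarrow> 'a" where
  "brace_lambda A a = (\<lambda>b\<in>carrier A. inv\<^bsub>A\<^esub> a \<otimes>\<^bsub>A\<^esub> (a \<star>\<^bsub>A\<^esub> b))"

definition brace_lambda_op :: "('a, 'm) skew_brace_scheme \<Rightarrow> 'a \<Rightarrow> 'a \<Rightarrow> 'a" where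
  "brace_lambda_op A a = (\<lambda>b\<in>carrier A. (a \<star>\<^bsub>A\<^esub> b) \<otimes>\<^bsub>A\<^esub> inv\<^bsub>A\<^esub> a)"

definition semidirect_product ::
  "('a, 'm) monoid_scheme \<Rightarrow> ('b, 'n) monoid_scheme \<Rightarrow> ('b \<Rightarrow> 'a \<Rightarrow> 'a) \<Rightarrow> ('a \<times> 'b) monoid" where
  "semidirect_product G H \<phi> =
    \<lparr>carrier = carrier G \<times> carrier H,
     mult = (\<lambda>(a1, b1) (a2, b2). (a1 \<otimes>\<^bsub>G\<^esub> \<phi> b1 a2, b1 \<otimes>\<^bsub>H\<^esub> b2)),
     one = (\<one>\<^bsub>G\<^esub>, \<one>\<^bsub>H\<^esub>)\<rparr>"

definition Lambda_op :: "('a, 'm) skew_brace_scheme \<Rightarrow> ('a \<times> 'a) monoid" where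
  "Lambda_op A = semidirect_product A (circ_group A) (brace_lambda_op A)"

definition commutator_group :: "('a, 'm) monoid_scheme \<Rightarrow> ('a, 'm) monoid_scheme" where
  "commutator_group G = G\<lparr>carrier := derived G (carrier G)\<rparr>"


section \<open>Ideals, quotients, annihilator and commutator\<close>

definition brace_ideal :: "'a set \<Rightarrow> ('a, 'm) skew_brace_scheme \<Rightarrow> bool" where
  "brace_ideal I A \<longleftrightarrow> I \<lhd> A \<and> I \<lhd> circ_group A \<and>
     (\<forall>a\<in>carrier A. brace_lambda A a ` I \<subseteq> I)"

text \<open>
  If \<open>I\<close> is an ideal, its cosets in $(A,\cdot)$ and $(A,\circ)$ coincide, so both operations
  of $A/I$ are given by the respective products of cosets as sets.
\<close>

definition brace_quotient ::
  "('a, 'm) skew_brace_scheme \<Rightarrow> 'a set \<Rightarrow> 'a set skew_brace" where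
  "brace_quotient A I =
    \<lparr>carrier = rcosets\<^bsub>A\<^esub> I, mult = set_mult A, one = I, circ = set_mult (circ_group A)\<rparr>"

definition group_center :: "('a, 'm) monoid_scheme \<Rightarrow> 'a set" where
  "group_center G = {z \<in> carrier G. \<forall>g\<in>carrier G. z \<otimes>\<^bsub>G\<^esub> g = g \<otimes>\<^bsub>G\<^esub> z}"

definition annihilator :: "('a, 'm) skew_brace_scheme \<Rightarrow> 'a set" where
  "annihilator A =
    kernel (circ_group A) (AutoGroup A) (brace_lambda A)
      \<inter> group_center A \<inter> group_center (circ_group A)"

definition brace_commutator_set :: "('a, 'm) skew_brace_scheme \<Rightarrow> 'a set" where
  "brace_commutator_set A = generate A
     ({a \<otimes>\<^bsub>A\<^esub> b \<otimes>\<^bsub>A\<^esub> inv\<^bsub>A\<^esub> a \<otimes>\<^bsub>A\<^esub> inv\<^bsub>A\<^esub> b | a b. a \<in> carrier A \<and> b \<in> carrier A} \<union>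
      {a \<otimes>\<^bsub>A\<^esub> brace_lambda A b (inv\<^bsub>A\<^esub> a) | a b. a \<in> carrier A \<and> b \<in> carrier A})"

definition brace_commutator ::
  "('a, 'm) skew_brace_scheme \<Rightarrow> ('a, 'm) skew_brace_scheme" where
  "brace_commutator A = A\<lparr>carrier := brace_commutator_set A\<rparr>"


section \<open>Isoclinism\<close>

definition brace_iso ::
  "('a, 'm) skew_brace_scheme \<Rightarrow> ('b, 'n) skew_brace_scheme \<Rightarrow> ('a \<Rightarrow> 'b) set" where
  "brace_iso A B = iso A B \<inter> iso (circ_group A) (circ_group B)"

text \<open>
  The maps $\theta$ and $\theta^*$ take two cosets of the annihilator; the set of values over all
  representatives is a singleton (lemmas \<open>theta_coset\<close> and \<open>theta_star_coset\<close>).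
\<close>

definition theta :: "('a, 'm) skew_brace_scheme \<Rightarrow> 'a set \<Rightarrow> 'a set \<Rightarrow> 'a" where
  "theta A X Y = the_elem
     {a \<otimes>\<^bsub>A\<^esub> b \<otimes>\<^bsub>A\<^esub> inv\<^bsub>A\<^esub> a \<otimes>\<^bsub>A\<^esub> inv\<^bsub>A\<^esub> b | a b. a \<in> X \<and> b \<in> Y}"

definition theta_star :: "('a, 'm) skew_brace_scheme \<Rightarrow> 'a set \<Rightarrow> 'a set \<Rightarrow> 'a" where
  "theta_star A X Y = the_elem
     {brace_lambda A a b \<otimes>\<^bsub>A\<^esub> inv\<^bsub>A\<^esub> b | a b. a \<in> X \<and> b \<in> Y}"

definition isoclinic :: "('a, 'm) skew_brace_scheme \<Rightarrow> ('b, 'n) skew_brace_scheme \<Rightarrow> bool" where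
  "isoclinic A B \<longleftrightarrow>
    (\<exists>\<xi>1 \<in> brace_iso (brace_quotient A (annihilator A)) (brace_quotient B (annihilator B)).
     \<exists>\<xi>2 \<in> brace_iso (brace_commutator A) (brace_commutator B).
       \<forall>X \<in> carrier (brace_quotient A (annihilator A)).
       \<forall>Y \<in> carrier (brace_quotient A (annihilator A)).
         \<xi>2 (theta A X Y) = theta B (\<xi>1 X) (\<xi>1 Y) \<and>
         \<xi>2 (theta_star A X Y) = theta_star B (\<xi>1 X) (\<xi>1 Y))"


section \<open>Well-definedness\<close>

context skew_left_brace
begin

lemma circ_closed [simp]: "\<lbrakk>a \<in> carrier A; b \<in> carrier A\<rbrakk> \<Longrightarrow> a \<star> b \<in> carrier A"
  using circ.m_closed by (simp add: circ_group_def)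

lemma circ_assoc:
  "\<lbrakk>a \<in> carrier A; b \<in> carrier A; c \<in> carrier A\<rbrakk> \<Longrightarrow> a \<star> b \<star> c = a \<star> (b \<star> c)"
  using circ.m_assoc by (simp add: circ_group_def)

lemma circ_one [simp]: "a \<in> carrier A \<Longrightarrow> a \<star> \<one> = a" "a \<in> carrier A \<Longrightarrow> \<one> \<star> a = a"
  using circ.r_one circ.l_one by (simp_all add: circ_group_def)

lemma lambda_closed [simp]:
  "\<lbrakk>a \<in> carrier A; b \<in> carrier A\<rbrakk> \<Longrightarrow> brace_lambda A a b \<in> carrier A"
  by (simp add: brace_lambda_def)

lemma circ_eq_lambda:
  "\<lbrakk>a \<in> carrier A; b \<in> carrier A\<rbrakk> \<Longrightarrow> a \<star> b = a \<otimes> brace_lambda A a b"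
  by (simp add: brace_lambda_def m_assoc[symmetric])

lemma cancel_right: "\<lbrakk>x \<in> carrier A; y \<in> carrier A\<rbrakk> \<Longrightarrow> x \<otimes> y \<otimes> inv y = x"
  by (simp add: m_assoc)

lemma lambda_mult:
  assumes "a \<in> carrier A" "b \<in> carrier A" "c \<in> carrier A"
  shows "brace_lambda A a (b \<otimes> c) = brace_lambda A a b \<otimes> brace_lambda A a c"
  using assms by (simp add: brace_lambda_def brace_distrib m_assoc)

lemma lambda_circ:
  assumes "a \<in> carrier A" "b \<in> carrier A" "c \<in> carrier A"
  shows "brace_lambda A (a \<star> b) c = brace_lambda A a (brace_lambda A b c)"
proof -
  have "(a \<star> b) \<otimes> brace_lambda A (a \<star> b) c = a \<star> (b \<star> c)"
    using assms by (simp add: circ_eq_lambda[symmetric] circ_assoc)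
  also have "\<dots> = a \<star> (b \<otimes> brace_lambda A b c)"
    using assms by (simp add: circ_eq_lambda[of b c])
  also have "\<dots> = (a \<star> b) \<otimes> brace_lambda A a (brace_lambda A b c)"
    using assms
    by (simp add: circ_eq_lambda[of a "b \<otimes> brace_lambda A b c"] circ_eq_lambda[of a b]
        lambda_mult m_assoc)
  finally show ?thesis using assms by simp
qed

lemma annihilator_iff:
  "z \<in> annihilator A \<longleftrightarrow> z \<in> carrier A \<and>
     (\<forall>b\<in>carrier A. brace_lambda A z b = b \<and> z \<otimes> b = b \<otimes> z \<and> z \<star> b = b \<star> z)"
proof -
  have "brace_lambda A z = (\<lambda>x\<in>carrier A. x) \<longleftrightarrow> (\<forall>b\<in>carrier A. brace_lambda A z b = b)"
    by (auto simp: brace_lambda_def fun_eq_iff restrict_def)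
  then show ?thesis
    by (auto simp: annihilator_def kernel_def AutoGroup_def BijGroup_def group_center_def
        circ_group_def)
qed

lemma annihilatorD:
  assumes "z \<in> annihilator A"
  shows "z \<in> carrier A"
    and "b \<in> carrier A \<Longrightarrow> brace_lambda A z b = b"
    and "b \<in> carrier A \<Longrightarrow> z \<otimes> b = b \<otimes> z"
    and "b \<in> carrier A \<Longrightarrow> z \<star> b = b \<star> z"
    and "b \<in> carrier A \<Longrightarrow> z \<star> b = z \<otimes> b"
    and "b \<in> carrier A \<Longrightarrow> brace_lambda A b z = z"
proof -
  show z: "z \<in> carrier A" using assms annihilator_iff by blast
  show l: "brace_lambda A z b = b" and c: "z \<otimes> b = b \<otimes> z" and d: "z \<star> b = b \<star> z"
    if "b \<in> carrier A" for b
    using that assms annihilator_iff by blast+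
  show e: "z \<star> b = z \<otimes> b" if "b \<in> carrier A" for b
    using that z by (simp add: circ_eq_lambda l)
  show "brace_lambda A b z = z" if b: "b \<in> carrier A"
  proof -
    have "b \<otimes> brace_lambda A b z = b \<otimes> z"
      using b z by (simp add: circ_eq_lambda[symmetric] d[symmetric] e c)
    then show ?thesis using b z by simp
  qed
qed

lemma annihilator_one: "\<one> \<in> annihilator A"
  by (simp add: annihilator_iff brace_lambda_def)

lemma annihilator_mult:
  assumes z: "z \<in> annihilator A" and w: "w \<in> annihilator A"
  shows "z \<otimes> w \<in> annihilator A"
  unfolding annihilator_iff
proof (intro conjI ballI)
  note zc = annihilatorD(1)[OF z] and wc = annihilatorD(1)[OF w]
  have eq: "z \<otimes> w = z \<star> w" using annihilatorD(5)[OF z wc] by simp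
  show "z \<otimes> w \<in> carrier A" using zc wc by simp
  fix b assume b: "b \<in> carrier A"
  show "brace_lambda A (z \<otimes> w) b = b"
    using b zc wc by (simp add: eq lambda_circ annihilatorD(2)[OF z] annihilatorD(2)[OF w])
  show "z \<otimes> w \<otimes> b = b \<otimes> (z \<otimes> w)"
    using b zc wc annihilatorD(3)[OF w b] annihilatorD(3)[OF z b] by (metis m_assoc)
  show "z \<otimes> w \<star> b = b \<star> (z \<otimes> w)"
    unfolding eq
    using b zc wc annihilatorD(4)[OF w b] annihilatorD(4)[OF z b] by (metis circ_assoc)
qed

lemma annihilator_inv:
  assumes z: "z \<in> annihilator A"
  shows "inv z \<in> annihilator A" and "inv\<^bsub>circ_group A\<^esub> z = inv z"
proof -
  have zc: "z \<in> carrier A" using annihilatorD(1)[OF z] .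
  have eq: "z \<star> inv z = \<one>" using zc annihilatorD(5)[OF z, of "inv z"] by simp
  then have eq': "inv z \<star> z = \<one>" using zc annihilatorD(4)[OF z, of "inv z"] by simp
  show "inv\<^bsub>circ_group A\<^esub> z = inv z"
    using circ.inv_equality[of "inv z" z] eq' zc by (simp add: circ_group_def)
  show "inv z \<in> annihilator A"
    unfolding annihilator_iff
  proof (intro conjI ballI)
    show "inv z \<in> carrier A" using zc by simp
    fix b assume b: "b \<in> carrier A"
    have "brace_lambda A (z \<star> inv z) b = brace_lambda A (inv z) b"
      using b zc annihilatorD(2)[OF z] by (simp add: lambda_circ)
    then show "brace_lambda A (inv z) b = b"
      using b by (simp add: eq brace_lambda_def)
    show "inv z \<otimes> b = b \<otimes> inv z"
      using annihilatorD(3)[OF z, of b] b zc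
      by (metis inv_closed inv_solve_left inv_solve_right m_assoc m_closed)
    have "inv z \<star> b = inv z \<star> (b \<star> z \<star> inv z)"
      using b zc by (simp add: circ_assoc eq)
    also have "\<dots> = inv z \<star> z \<star> (b \<star> inv z)"
      using b zc by (simp add: circ_assoc annihilatorD(4)[OF z b, symmetric])
    finally show "inv z \<star> b = b \<star> inv z"
      using b zc by (simp add: eq')
  qed
qed

lemma annihilator_ideal: "brace_ideal (annihilator A) A"
  unfolding brace_ideal_def
proof (intro conjI ballI)
  have "annihilator A \<subseteq> carrier A" using annihilatorD(1) by blast
  then have "subgroup (annihilator A) A"
    by (intro subgroup.intro) (auto intro: annihilator_one annihilator_mult annihilator_inv)
  then show "annihilator A \<lhd> A"
    using annihilatorD(3) by (intro normalI) (auto simp: r_coset_def l_coset_def)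
  have "subgroup (annihilator A) (circ_group A)"
    using annihilatorD(1) annihilatorD(5) annihilator_one annihilator_mult annihilator_inv
    by (intro subgroup.intro) (auto simp: circ_group_def)
  then show "annihilator A \<lhd> circ_group A"
    using annihilatorD(4)
    by (intro circ.normalI) (auto simp: r_coset_def l_coset_def circ_group_def)
  show "brace_lambda A a ` annihilator A \<subseteq> annihilator A" if "a \<in> carrier A" for a
    using that annihilatorD(6) by auto
qed

lemma theta_coset:
  assumes a: "a \<in> carrier A" and b: "b \<in> carrier A"
  shows "theta A (annihilator A #> a) (annihilator A #> b) = a \<otimes> b \<otimes> inv a \<otimes> inv b"
proof -
  have rep: "(z \<otimes> a) \<otimes> (w \<otimes> b) \<otimes> inv (z \<otimes> a) \<otimes> inv (w \<otimes> b) = a \<otimes> b \<otimes> inv a \<otimes> inv b"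
    if z: "z \<in> annihilator A" and w: "w \<in> annihilator A" for z w
  proof -
    have zc: "z \<in> carrier A" and wc: "w \<in> carrier A"
      using z w annihilatorD(1) by auto
    have 1: "(z \<otimes> a) \<otimes> y \<otimes> inv (z \<otimes> a) = a \<otimes> y \<otimes> inv a" if y: "y \<in> carrier A" for y
      using a y zc annihilatorD(3)[OF z, of "a \<otimes> y \<otimes> inv a"]
      by (simp add: inv_mult_group m_assoc[symmetric] cancel_right)
    have "a \<otimes> (w \<otimes> b) \<otimes> inv a = w \<otimes> (a \<otimes> b \<otimes> inv a)"
      using a b wc annihilatorD(3)[OF w a] m_assoc[of a w b] m_assoc[of w a b]
        m_assoc[of w "a \<otimes> b" "inv a"] by simp
    also have "\<dots> = a \<otimes> b \<otimes> inv a \<otimes> w"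
      using a b annihilatorD(3)[OF w] by simp
    finally have 2: "a \<otimes> (w \<otimes> b) \<otimes> inv a = a \<otimes> b \<otimes> inv a \<otimes> w" .
    have 3: "inv (w \<otimes> b) = inv w \<otimes> inv b"
      using b wc annihilatorD(3)[OF w b] by (simp add: inv_mult_group)
    have "a \<otimes> b \<otimes> inv a \<otimes> w \<otimes> (inv w \<otimes> inv b) = a \<otimes> b \<otimes> inv a \<otimes> inv b"
      using a b wc by (simp add: m_assoc[symmetric] cancel_right)
    then show ?thesis using a b wc by (simp only: 1 2 3 m_closed)
  qed
  moreover have "a \<in> annihilator A #> a" "b \<in> annihilator A #> b"
    using a b annihilator_one by (force simp: r_coset_def)+
  ultimately have
    "{x \<otimes> y \<otimes> inv x \<otimes> inv y | x y. x \<in> annihilator A #> a \<and> y \<in> annihilator A #> b}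
      = {a \<otimes> b \<otimes> inv a \<otimes> inv b}"
    by (intro equalityI subsetI) (simp_all only: r_coset_def mem_Collect_eq UN_iff singleton_iff, metis+)
  then show ?thesis by (simp add: theta_def)
qed

lemma theta_star_coset:
  assumes a: "a \<in> carrier A" and b: "b \<in> carrier A"
  shows "theta_star A (annihilator A #> a) (annihilator A #> b) = brace_lambda A a b \<otimes> inv b"
proof -
  have rep: "brace_lambda A (z \<otimes> a) (w \<otimes> b) \<otimes> inv (w \<otimes> b) = brace_lambda A a b \<otimes> inv b"
    if "z \<in> annihilator A" "w \<in> annihilator A" for z w
  proof -
    note zc = annihilatorD(1)[OF that(1)] and wc = annihilatorD(1)[OF that(2)]
    have "brace_lambda A (z \<otimes> a) (w \<otimes> b) = brace_lambda A a (w \<otimes> b)"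
      using a b zc wc annihilatorD(2)[OF that(1)] annihilatorD(5)[OF that(1) a, symmetric]
      by (simp add: lambda_circ)
    also have "\<dots> = w \<otimes> brace_lambda A a b"
      using a b wc annihilatorD(6)[OF that(2) a] by (simp add: lambda_mult)
    also have "\<dots> = brace_lambda A a b \<otimes> w"
      using a b annihilatorD(3)[OF that(2)] by simp
    finally show ?thesis
      using a b wc annihilatorD(3)[OF that(2) b]
      by (simp add: inv_mult_group m_assoc[symmetric] cancel_right)
  qed
  moreover have "a \<in> annihilator A #> a" "b \<in> annihilator A #> b"
    using a b annihilator_one by (force simp: r_coset_def)+
  ultimately have
    "{brace_lambda A x y \<otimes> inv y | x y. x \<in> annihilator A #> a \<and> y \<in> annihilator A #> b}
      = {brace_lambda A a b \<otimes> inv b}"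
    by (intro equalityI subsetI) (simp_all only: r_coset_def mem_Collect_eq UN_iff singleton_iff, metis+)
  then show ?thesis by (simp add: theta_star_def)
qed

end

end

theory Submission
  imports Defs
begin

text \<open>
  The commutator subgroup of a semidirect product $G \rtimes_\phi H$ is $D \times H'$, where $D$ is
  generated by the commutators of $G$ and the elements $\phi_h(g) g^{-1}$. For
  $\Lambda_{A^{\mathrm{op}}}$ this gives $A' \times (A,\circ)'$, and the isomorphism is
  $\xi_2 \times \xi_2$. The point is that $\xi_2$ maps $(A,\circ)'$ onto $(B,\circ)'$. Write
  $a * b = \lambda_a(b) b^{-1}$ and let $c$ be the commutator of $a$ and $b$ in $(A,\circ)$. Then
  \[ c \, (c * (b \circ a)) = (a \circ b)(b \circ a)^{-1}
      = (a (a * b) a^{-1}) \, [a, b] \, (b (b * a)^{-1} b^{-1}). \]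
  As $\xi_2(x)$ represents $\xi_1(\overline{x})$ for $x \in A'$, $\xi_2$ respects conjugation
  by $A$ on $A'$, so it carries the right-hand side, the factor $c * (b \circ a)$ and hence $c$ to
  their counterparts in $B$.
\<close>

section \<open>The commutator subgroup of a semidirect product\<close>

definition commutator :: "('a, 'm) monoid_scheme \<Rightarrow> 'a \<Rightarrow> 'a \<Rightarrow> 'a" where
  "commutator G a b = a \<otimes>\<^bsub>G\<^esub> b \<otimes>\<^bsub>G\<^esub> inv\<^bsub>G\<^esub> a \<otimes>\<^bsub>G\<^esub> inv\<^bsub>G\<^esub> b"

definition commutators :: "('a, 'm) monoid_scheme \<Rightarrow> 'a set" where
  "commutators G = {commutator G a b | a b. a \<in> carrier G \<and> b \<in> carrier G}"

lemma derived_eq_generate_commutators: "derived G (carrier G) = generate G (commutators G)"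
  unfolding derived_def commutators_def commutator_def by (rule arg_cong[of _ _ "generate G"]) auto

lemma commutatorsI:
  "\<lbrakk>a \<in> carrier G; b \<in> carrier G\<rbrakk> \<Longrightarrow> commutator G a b \<in> commutators G"
  by (auto simp: commutators_def)

context group
begin

lemma commutator_closed [simp]:
  "\<lbrakk>a \<in> carrier G; b \<in> carrier G\<rbrakk> \<Longrightarrow> commutator G a b \<in> carrier G"
  by (simp add: commutator_def)

lemma commutators_subset: "commutators G \<subseteq> carrier G"
  by (auto simp: commutators_def)

lemma inv_mult_cancel: "\<lbrakk>x \<in> carrier G; y \<in> carrier G\<rbrakk> \<Longrightarrow> inv x \<otimes> (x \<otimes> y) = y"
  by (simp add: m_assoc[symmetric])

lemma conj_eq_commutator_mult:
  "\<lbrakk>a \<in> carrier G; x \<in> carrier G\<rbrakk> \<Longrightarrow> a \<otimes> x \<otimes> inv a = commutator G a x \<otimes> x"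
  by (simp add: commutator_def m_assoc)

lemma commutator_mult_swap:
  assumes "a \<in> carrier G" "b \<in> carrier G"
  shows "commutator G a b \<otimes> (b \<otimes> a) = a \<otimes> b"
  using assms by (simp add: commutator_def m_assoc inv_mult_cancel)

text \<open>Conjugating \<open>h\<close> by \<open>x\<close> only multiplies it on the left by
  \<open>commutator G x h\<close>, which already lies in \<open>K\<close>. Hence no conjugates of
  elements of \<open>K\<close> have to be added to the generators.\<close>

lemma normal_generate_superset_commutators:
  assumes K: "K \<subseteq> carrier G" and comm: "commutators G \<subseteq> K"
  shows "generate G K \<lhd> G"
proof (rule normal_invI[OF generate_is_subgroup[OF K]])
  interpret S: subgroup "generate G K" G by (rule generate_is_subgroup[OF K])
  fix x h assume x: "x \<in> carrier G" and h: "h \<in> generate G K"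
  have "commutator G x h \<in> generate G K"
    using comm commutatorsI[of x G h] x S.mem_carrier[OF h] generate.incl[of _ K G] by blast
  then show "x \<otimes> h \<otimes> inv x \<in> generate G K"
    using x h by (simp add: conj_eq_commutator_mult)
qed

text \<open>Since x y = [x, y] (y x), the cosets of x y and y x differ by a left factor from
  \<open>N\<close>, which a right coset of \<open>N\<close> absorbs.\<close>

lemma comm_group_factor:
  assumes N: "N \<lhd> G" and comm: "commutators G \<subseteq> N"
  shows "comm_group (G Mod N)"
proof (rule group.group_comm_groupI[OF normal.factorgroup_is_group[OF N]])
  interpret normal N G by fact
  fix X Y assume "X \<in> carrier (G Mod N)" "Y \<in> carrier (G Mod N)"
  then obtain x y where x: "x \<in> carrier G" and y: "y \<in> carrier G" and X: "X = N #> x" and Y: "Y = N #> y"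
    by (auto simp: FactGroup_def RCOSETS_def)
  have c: "commutator G x y \<in> N" using comm commutatorsI[OF x y] by blast
  have "N #> (x \<otimes> y) = N #> (commutator G x y \<otimes> (y \<otimes> x))"
    using x y by (simp add: commutator_mult_swap)
  also have "\<dots> = N #> (y \<otimes> x)"
    using coset_mult_assoc[OF subset, of "commutator G x y" "y \<otimes> x"] rcos_const[OF is_group c] x y
    by simp
  finally show "X \<otimes>\<^bsub>G Mod N\<^esub> Y = Y \<otimes>\<^bsub>G Mod N\<^esub> X"
    using x y by (simp add: X Y FactGroup_def rcos_sum)
qed

end

section \<open>Semidirect products and their commutator subgroups\<close>

text \<open>The action consists of endomorphisms subject to the two action laws; these make
  \<open>\<phi> h\<close> and the map of the inverse of \<open>h\<close> mutually inverse on the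
  carrier, so the maps are automorphisms there.\<close>

locale semidirect = G: group G + H: group H
  for G :: "('a, 'm) monoid_scheme" (structure) and H :: "('b, 'n) monoid_scheme"
    and \<phi> :: "'b \<Rightarrow> 'a \<Rightarrow> 'a" +
  assumes action_hom: "h \<in> carrier H \<Longrightarrow> \<phi> h \<in> hom G G"
    and action_one: "x \<in> carrier G \<Longrightarrow> \<phi> \<one>\<^bsub>H\<^esub> x = x"
    and action_mult: "\<lbrakk>h \<in> carrier H; k \<in> carrier H; x \<in> carrier G\<rbrakk>
      \<Longrightarrow> \<phi> (h \<otimes>\<^bsub>H\<^esub> k) x = \<phi> h (\<phi> k x)"
begin

abbreviation "P \<equiv> semidirect_product G H \<phi>"

text \<open>The elements of the second kind are commutators too: in the semidirect product, (1, h)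
  and (x, 1) have the commutator (\<open>\<phi> h x \<otimes> inv x\<close>, 1).\<close>

definition action_gens :: "'a set" where
  "action_gens = commutators G \<union> {\<phi> h x \<otimes> inv x | h x. h \<in> carrier H \<and> x \<in> carrier G}"

lemma action_closed [simp]: "\<lbrakk>h \<in> carrier H; x \<in> carrier G\<rbrakk> \<Longrightarrow> \<phi> h x \<in> carrier G"
  using action_hom hom_in_carrier by fastforce

lemma action_of_mult:
  "\<lbrakk>h \<in> carrier H; x \<in> carrier G; y \<in> carrier G\<rbrakk> \<Longrightarrow> \<phi> h (x \<otimes> y) = \<phi> h x \<otimes> \<phi> h y"
  using action_hom hom_mult by fastforce

lemma action_of_one: "h \<in> carrier H \<Longrightarrow> \<phi> h \<one> = \<one>"
  using action_hom hom_one G.is_group by blast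

lemma P_simps:
  "carrier P = carrier G \<times> carrier H"
  "(a, h) \<otimes>\<^bsub>P\<^esub> (b, k) = (a \<otimes> \<phi> h b, h \<otimes>\<^bsub>H\<^esub> k)"
  "\<one>\<^bsub>P\<^esub> = (\<one>, \<one>\<^bsub>H\<^esub>)"
  by (simp_all add: semidirect_product_def)

lemma P_group: "group P"
proof (rule groupI)
  fix p assume "p \<in> carrier P"
  then obtain a h where p: "p = (a, h)" "a \<in> carrier G" "h \<in> carrier H"
    by (auto simp: P_simps)
  \<comment> \<open>A left inverse must have second coordinate h^-1, and then its first coordinate
    must cancel the image of \<open>a\<close> under the action of h^-1.\<close>
  have "(\<phi> (inv\<^bsub>H\<^esub> h) (inv a), inv\<^bsub>H\<^esub> h) \<otimes>\<^bsub>P\<^esub> p = \<one>\<^bsub>P\<^esub>"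
    using p by (simp add: P_simps action_of_mult[symmetric] action_of_one)
  then show "\<exists>q\<in>carrier P. q \<otimes>\<^bsub>P\<^esub> p = \<one>\<^bsub>P\<^esub>"
    using p by (metis H.inv_closed G.inv_closed P_simps(1) SigmaI action_closed)
qed (auto simp: P_simps action_one action_of_mult action_mult G.m_assoc H.m_assoc)

lemma action_gensI:
  "\<lbrakk>a \<in> carrier G; b \<in> carrier G\<rbrakk> \<Longrightarrow> commutator G a b \<in> action_gens"
  "\<lbrakk>h \<in> carrier H; x \<in> carrier G\<rbrakk> \<Longrightarrow> \<phi> h x \<otimes> inv x \<in> action_gens"
  unfolding action_gens_def commutators_def by blast+

lemma action_gensE:
  assumes "g \<in> action_gens"
  obtains (comm) a b where "a \<in> carrier G" "b \<in> carrier G" "g = commutator G a b"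
    | (action) h x where "h \<in> carrier H" "x \<in> carrier G" "g = \<phi> h x \<otimes> inv x"
  using assms unfolding action_gens_def commutators_def by blast

lemma action_gens_subset: "action_gens \<subseteq> carrier G"
  using G.commutators_subset by (auto simp: action_gens_def)

text \<open>For the inclusion from left to right, the two coordinates are tested separately: the
  first through a homomorphism into the abelian group G/D, the second through the projection to
  \<open>H\<close>. Conversely, the embedded copies of \<open>action_gens\<close> and of the
  commutators of \<open>H\<close> are commutators of \<open>P\<close>.\<close>

theorem derived_semidirect_product:
  "derived P (carrier P) = generate G action_gens \<times> derived H (carrier H)"
proof (intro equalityI subsetI)
  interpret P: group P by (rule P_group)
  let ?D = "generate G action_gens"
  have comm: "commutators G \<subseteq> action_gens" by (auto simp: action_gens_def)
  interpret D: normal ?D G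
    by (rule G.normal_generate_superset_commutators[OF action_gens_subset comm])
  interpret Q: comm_group "G Mod ?D"
    using comm generate.incl[of _ action_gens G]
    by (intro G.comm_group_factor[OF D.normal_axioms]) blast
  \<comment> \<open>The first projection is twisted by the action and need not be a homomorphism.
    Modulo D the action is trivial, and the projection becomes one.\<close>
  have q_action: "?D #> \<phi> h x = ?D #> x" if h: "h \<in> carrier H" and x: "x \<in> carrier G" for h x
  proof -
    have "\<phi> h x \<otimes> inv x \<in> action_gens" using h x by (rule action_gensI)
    then have "\<phi> h x \<in> ?D #> x"
      using h x by (intro D.rcos_module_rev[OF G.is_group]) (auto intro: generate.incl)
    then show ?thesis using x G.repr_independence D.subgroup_axioms by blast
  qed
  have "(\<lambda>p. ?D #> fst p) \<in> hom P (G Mod ?D)"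
    by (rule homI)
      (auto simp: P_simps FactGroup_def G.rcosetsI[OF D.subset] D.rcos_sum[symmetric] q_action)
  then interpret f: group_hom P "G Mod ?D" "\<lambda>p. ?D #> fst p"
    by unfold_locales
  have "snd \<in> hom P H" by (rule homI) (auto simp: P_simps)
  then interpret s: group_hom P H snd by unfold_locales
  fix p assume p: "p \<in> derived P (carrier P)"
  have pc: "p \<in> carrier P" using P.derived_in_carrier p by blast
  \<comment> \<open>A homomorphism carries the derived subgroup onto the derived subgroup of its
    image, which is trivial inside an abelian group.\<close>
  have image: "(\<lambda>p. ?D #> fst p) ` derived P (carrier P) = {\<one>\<^bsub>G Mod ?D\<^esub>}"
    unfolding f.derived_img[OF order_refl, symmetric]
    by (rule Q.derived_eq_singleton) (use f.hom_closed in blast)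
  have "?D #> fst p = \<one>\<^bsub>G Mod ?D\<^esub>"
    using imageI[OF p, of "\<lambda>p. ?D #> fst p"] unfolding image by (rule singletonD)
  then have "?D #> fst p = ?D" by (simp only: FactGroup_def monoid.simps)
  moreover have "fst p \<in> carrier G" using pc by (auto simp: P_simps)
  ultimately have "fst p \<in> ?D" by (rule G.coset_join1[OF _ _ D.subgroup_axioms])
  moreover have "snd p \<in> derived H (snd ` carrier P)"
    using s.derived_img[OF order_refl] p by auto
  then have "snd p \<in> derived H (carrier H)"
    using H.mono_derived[of "snd ` carrier P" "carrier H"] s.hom_closed by blast
  ultimately show "p \<in> ?D \<times> derived H (carrier H)" by (cases p) auto
next
  interpret P: group P by (rule P_group)
  let ?E = "derived P (carrier P)"
  interpret E: subgroup ?E P by (rule P.derived_is_subgroup) simp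
  have comm_E: "commutator P p q \<in> ?E" if "p \<in> carrier P" "q \<in> carrier P" for p q
    using that by (simp add: derived_eq_generate_commutators commutatorsI generate.incl)
  have inv_G: "inv\<^bsub>P\<^esub> (a, \<one>\<^bsub>H\<^esub>) = (inv a, \<one>\<^bsub>H\<^esub>)" if "a \<in> carrier G" for a
    using that by (intro P.inv_equality) (auto simp: P_simps action_one)
  have inv_H: "inv\<^bsub>P\<^esub> (\<one>, h) = (\<one>, inv\<^bsub>H\<^esub> h)" if "h \<in> carrier H" for h
    using that by (intro P.inv_equality) (auto simp: P_simps action_of_one)
  have gens_E: "(x, \<one>\<^bsub>H\<^esub>) \<in> ?E" if "x \<in> action_gens" for x
    using that
  proof (cases rule: action_gensE)
      case (comm a b)
      then have "commutator P (a, \<one>\<^bsub>H\<^esub>) (b, \<one>\<^bsub>H\<^esub>) = (x, \<one>\<^bsub>H\<^esub>)"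
        by (simp add: commutator_def inv_G P_simps action_one)
      then show ?thesis
        using comm_E[of "(a, \<one>\<^bsub>H\<^esub>)" "(b, \<one>\<^bsub>H\<^esub>)"] comm by (simp add: P_simps)
  next
      case (action h a)
      then have "commutator P (\<one>, h) (a, \<one>\<^bsub>H\<^esub>) = (x, \<one>\<^bsub>H\<^esub>)"
        by (simp add: commutator_def inv_G inv_H P_simps action_of_one action_one)
      then show ?thesis using comm_E[of "(\<one>, h)" "(a, \<one>\<^bsub>H\<^esub>)"] action by (simp add: P_simps)
  qed
  have "(\<lambda>x. (x, \<one>\<^bsub>H\<^esub>)) \<in> hom G P" by (rule homI) (auto simp: P_simps action_one)
  then have i: "group_hom G P (\<lambda>x. (x, \<one>\<^bsub>H\<^esub>))"
    by (simp add: group_hom_def group_hom_axioms_def P.is_group G.is_group)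
  have "(\<lambda>h. (\<one>, h)) \<in> hom H P" by (rule homI) (auto simp: P_simps action_of_one)
  then have j: "group_hom H P (\<lambda>h. (\<one>, h))"
    by (simp add: group_hom_def group_hom_axioms_def P.is_group H.is_group)
  have "generate P ((\<lambda>x. (x, \<one>\<^bsub>H\<^esub>)) ` action_gens) \<subseteq> ?E"
    by (rule P.generate_subgroup_incl[OF _ E.subgroup_axioms]) (auto simp: gens_E)
  then have i_E: "(x, \<one>\<^bsub>H\<^esub>) \<in> ?E" if "x \<in> generate G action_gens" for x
    using that group_hom.generate_img[OF i action_gens_subset] by blast
  have "derived P ((\<lambda>h. (\<one>, h)) ` carrier H) \<subseteq> ?E"
    by (rule P.mono_derived) (auto simp: P_simps)
  then have j_E: "(\<one>, h) \<in> ?E" if "h \<in> derived H (carrier H)" for h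
    using that group_hom.derived_img[OF j order_refl] by blast
  fix p assume "p \<in> generate G action_gens \<times> derived H (carrier H)"
  then obtain x h where p: "p = (x, h)" and x: "x \<in> generate G action_gens"
    and h: "h \<in> derived H (carrier H)" by auto
  have "x \<in> carrier G" "h \<in> carrier H"
    using x h G.generate_in_carrier[OF action_gens_subset] H.derived_in_carrier[OF order_refl] by auto
  \<comment> \<open>The two embedded pieces recombine by (x, h) = (x, 1)(1, h).\<close>
  then have "p = (x, \<one>\<^bsub>H\<^esub>) \<otimes>\<^bsub>P\<^esub> (\<one>, h)" by (simp add: p P_simps action_of_one)
  then show "p \<in> ?E" by (simp only: E.m_closed[OF i_E[OF x] j_E[OF h]])
qed

end

section \<open>The commutator of a skew left brace\<close>

text \<open>This is the product a * b of the overview, and the value of \<open>theta_star\<close> on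
  the cosets of \<open>a\<close> and \<open>b\<close>.\<close>

definition lambda_star :: "('a, 'm) skew_brace_scheme \<Rightarrow> 'a \<Rightarrow> 'a \<Rightarrow> 'a" where
  "lambda_star A a b = brace_lambda A a b \<otimes>\<^bsub>A\<^esub> inv\<^bsub>A\<^esub> b"

context skew_left_brace
begin

lemma circ_group_simps [simp]:
  "carrier (circ_group A) = carrier A" "mult (circ_group A) = circ A" "one (circ_group A) = \<one>"
  by (simp_all add: circ_group_def)

lemma circ_inv_closed [simp]: "a \<in> carrier A \<Longrightarrow> inv\<^bsub>circ_group A\<^esub> a \<in> carrier A"
  using circ.inv_closed by simp

lemma lambda_hom: "a \<in> carrier A \<Longrightarrow> brace_lambda A a \<in> hom A A"
  by (rule homI) (auto simp: lambda_mult)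

lemma lambda_inv:
  "\<lbrakk>a \<in> carrier A; b \<in> carrier A\<rbrakk> \<Longrightarrow> brace_lambda A a (inv b) = inv (brace_lambda A a b)"
  using group_hom.hom_inv[of A A "brace_lambda A a" b] lambda_hom[of a] is_group
  by (simp add: group_hom_def group_hom_axioms_def)

lemma lambda_star_closed [simp]:
  "\<lbrakk>a \<in> carrier A; b \<in> carrier A\<rbrakk> \<Longrightarrow> lambda_star A a b \<in> carrier A"
  by (simp add: lambda_star_def)

lemma lambda_eq_lambda_star_mult:
  "\<lbrakk>a \<in> carrier A; b \<in> carrier A\<rbrakk> \<Longrightarrow> brace_lambda A a b = lambda_star A a b \<otimes> b"
  by (simp add: lambda_star_def m_assoc)

section \<open>The opposite action of (A, circ) on the multiplicative group\<close>

lemma lambda_op_eq: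
  "\<lbrakk>a \<in> carrier A; b \<in> carrier A\<rbrakk>
    \<Longrightarrow> brace_lambda_op A a b = a \<otimes> brace_lambda A a b \<otimes> inv a"
  by (simp add: brace_lambda_op_def circ_eq_lambda)

lemma lambda_op_closed [simp]:
  "\<lbrakk>a \<in> carrier A; b \<in> carrier A\<rbrakk> \<Longrightarrow> brace_lambda_op A a b \<in> carrier A"
  by (simp add: lambda_op_eq)

text \<open>The distributive law makes each map an endomorphism. Multiplicativity in the acting
  element comes from that of \<lambda>: the conjugations by a and by \<lambda>_a(b) combine to
  conjugation by a \<lambda>_a(b), which is the circle product of a and b.\<close>

sublocale op: semidirect A "circ_group A" "brace_lambda_op A"
proof
  fix a assume a: "a \<in> carrier (circ_group A)"
  show "brace_lambda_op A a \<in> hom A A"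
  proof (rule homI)
    fix x y assume "x \<in> carrier A" "y \<in> carrier A"
    then show "brace_lambda_op A a (x \<otimes> y) = brace_lambda_op A a x \<otimes> brace_lambda_op A a y"
      using a by (simp add: brace_lambda_op_def brace_distrib m_assoc)
  qed (use a in auto)
next
  fix x assume "x \<in> carrier A"
  then show "brace_lambda_op A \<one>\<^bsub>circ_group A\<^esub> x = x" by (simp add: brace_lambda_op_def)
next
  fix a b x
  assume "a \<in> carrier (circ_group A)" "b \<in> carrier (circ_group A)" "x \<in> carrier A"
  then have a: "a \<in> carrier A" and b: "b \<in> carrier A" and x: "x \<in> carrier A" by auto
  have "brace_lambda_op A a (brace_lambda_op A b x)
      = a \<otimes> brace_lambda A a b \<otimes> brace_lambda A (a \<star> b) x \<otimes> inv (brace_lambda A a b) \<otimes> inv a"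
    using a b x by (simp add: lambda_op_eq lambda_mult lambda_inv lambda_circ m_assoc)
  also have "\<dots> = (a \<star> b) \<otimes> brace_lambda A (a \<star> b) x \<otimes> inv (a \<star> b)"
    using a b x by (simp add: circ_eq_lambda[of a b] inv_mult_group m_assoc)
  finally show "brace_lambda_op A (a \<otimes>\<^bsub>circ_group A\<^esub> b) x
      = brace_lambda_op A a (brace_lambda_op A b x)"
    using a b x by (simp add: lambda_op_eq)
qed

section \<open>Generating sets of the brace commutator A'\<close>

definition star_gens :: "'a set" where
  "star_gens = commutators A \<union> {lambda_star A a b | a b. a \<in> carrier A \<and> b \<in> carrier A}"

lemma star_gens_subset: "star_gens \<subseteq> carrier A"
  using commutators_subset by (auto simp: star_gens_def)

text \<open>The generator a \<lambda>_b(a^-1) is the inverse of b * a. With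
  \<open>star_gens\<close>, the generators become exactly the values of \<open>theta\<close> and
  \<open>theta_star\<close>, on which \<open>\<xi>2\<close> is prescribed.\<close>

lemma brace_commutator_set_eq_star_gens: "brace_commutator_set A = generate A star_gens"
proof -
  define K where "K = commutators A \<union> {a \<otimes> brace_lambda A b (inv a) | a b. a \<in> carrier A \<and> b \<in> carrier A}"
  have gen: "brace_commutator_set A = generate A K"
    by (simp add: brace_commutator_set_def K_def commutators_def commutator_def)
  have inv_star: "a \<otimes> brace_lambda A b (inv a) = inv (lambda_star A b a)"
    if "a \<in> carrier A" "b \<in> carrier A" for a b
    using that by (simp add: lambda_star_def lambda_inv inv_mult_group)
  have K: "K \<subseteq> carrier A"
    using commutators_subset by (auto simp: K_def)
  show ?thesis
    unfolding gen
  proof (intro equalityI generate_subgroup_incl generate_is_subgroup K star_gens_subset subsetI)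
    fix x assume "x \<in> K"
    then consider "x \<in> commutators A"
      | a b where "a \<in> carrier A" "b \<in> carrier A" "x = inv (lambda_star A b a)"
      by (auto simp: K_def inv_star)
    then show "x \<in> generate A star_gens"
      by cases (auto simp: star_gens_def intro: generate.incl intro!: generate.inv)
  next
    fix x assume "x \<in> star_gens"
    then consider "x \<in> commutators A"
      | a b where "a \<in> carrier A" "b \<in> carrier A" "x = lambda_star A b a"
      by (auto simp: star_gens_def)
    then show "x \<in> generate A K"
    proof cases
      case 1
      then show ?thesis by (auto simp: K_def intro: generate.incl)
    next
      case 2
      then have "inv (a \<otimes> brace_lambda A b (inv a)) = x" by (simp add: inv_star)
      moreover have "a \<otimes> brace_lambda A b (inv a) \<in> K" using 2 by (auto simp: K_def)
      ultimately show ?thesis using generate.inv by metis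
    qed
  qed
qed

lemma brace_commutator_normal: "brace_commutator_set A \<lhd> A"
  unfolding brace_commutator_set_eq_star_gens
  by (rule normal_generate_superset_commutators[OF star_gens_subset]) (simp add: star_gens_def)

lemmas brace_commutator_subgroup = normal_imp_subgroup[OF brace_commutator_normal]

lemmas comm_closed [simp] =
  subgroup.mem_carrier[OF brace_commutator_subgroup]
  subgroup.one_closed[OF brace_commutator_subgroup]
  subgroup.m_closed[OF brace_commutator_subgroup]
  subgroup.m_inv_closed[OF brace_commutator_subgroup]

lemma commutator_in [simp]:
  "\<lbrakk>a \<in> carrier A; b \<in> carrier A\<rbrakk> \<Longrightarrow> commutator A a b \<in> brace_commutator_set A"
  unfolding brace_commutator_set_eq_star_gens star_gens_def
  by (intro generate.incl UnI1 commutatorsI)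

lemma lambda_star_in [simp]:
  "\<lbrakk>a \<in> carrier A; b \<in> carrier A\<rbrakk> \<Longrightarrow> lambda_star A a b \<in> brace_commutator_set A"
  unfolding brace_commutator_set_eq_star_gens star_gens_def by (intro generate.incl UnI2) blast

lemma conj_in:
  "\<lbrakk>a \<in> carrier A; x \<in> brace_commutator_set A\<rbrakk> \<Longrightarrow> a \<otimes> x \<otimes> inv a \<in> brace_commutator_set A"
  by (simp add: conj_eq_commutator_mult)

lemma lambda_in:
  "\<lbrakk>a \<in> carrier A; x \<in> brace_commutator_set A\<rbrakk> \<Longrightarrow> brace_lambda A a x \<in> brace_commutator_set A"
  by (simp add: lambda_eq_lambda_star_mult)

text \<open>By \<open>op_star\<close> the generators from the opposite action and those from
  \<lambda> differ only by a commutator factor, and both generating sets contain all commutators.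
  This identifies the first factor of the derived subgroup of \<open>Lambda_op A\<close> with
  A'.\<close>

lemma brace_commutator_set_eq_action_gens: "brace_commutator_set A = generate A op.action_gens"
proof (rule equalityI)
  interpret D: normal "generate A op.action_gens" A
    by (rule normal_generate_superset_commutators[OF op.action_gens_subset])
      (simp add: op.action_gens_def)
  have op_in: "brace_lambda_op A a b \<otimes> inv b \<in> generate A op.action_gens"
    if "a \<in> carrier A" "b \<in> carrier A" for a b
    using that by (intro generate.incl op.action_gensI) simp_all
  have comm_in: "commutator A a b \<in> generate A op.action_gens"
    if "a \<in> carrier A" "b \<in> carrier A" for a b
    using that by (intro generate.incl op.action_gensI)
  have op_star: "brace_lambda_op A a b \<otimes> inv b
      = commutator A a (brace_lambda A a b) \<otimes> lambda_star A a b"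
    if "a \<in> carrier A" "b \<in> carrier A" for a b
    using that by (simp add: lambda_op_eq commutator_def lambda_star_def m_assoc inv_mult_cancel)
  show "brace_commutator_set A \<subseteq> generate A op.action_gens"
    unfolding brace_commutator_set_eq_star_gens
  proof (intro generate_subgroup_incl D.subgroup_axioms subsetI)
    fix x assume "x \<in> star_gens"
    then consider a b where "a \<in> carrier A" "b \<in> carrier A" "x = commutator A a b"
      | a b where "a \<in> carrier A" "b \<in> carrier A" "x = lambda_star A a b"
      unfolding star_gens_def commutators_def by blast
    then show "x \<in> generate A op.action_gens"
    proof cases
      case 1
      then show ?thesis using comm_in by blast
    next
      case 2
      then have "x = inv (commutator A a (brace_lambda A a b)) \<otimes> (brace_lambda_op A a b \<otimes> inv b)"
        by (simp add: op_star m_assoc[symmetric])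
      moreover have "inv (commutator A a (brace_lambda A a b)) \<in> generate A op.action_gens"
        using 2 comm_in by (intro D.m_inv_closed) simp
      ultimately show ?thesis
        using op_in[OF 2(1,2)] D.m_closed by blast
    qed
  qed
  show "generate A op.action_gens \<subseteq> brace_commutator_set A"
  proof (intro generate_subgroup_incl brace_commutator_subgroup subsetI)
    fix x assume "x \<in> op.action_gens"
    then show "x \<in> brace_commutator_set A"
      by (cases rule: op.action_gensE) (simp_all add: op_star)
  qed
qed

lemma derived_Lambda_op:
  "derived (Lambda_op A) (carrier (Lambda_op A))
    = brace_commutator_set A \<times> derived (circ_group A) (carrier A)"
  using op.derived_semidirect_product
  by (simp add: Lambda_op_def brace_commutator_set_eq_action_gens)

section \<open>Commutators of the circle group inside A'\<close>

lemma brace_commutator_circ_subgroup: "subgroup (brace_commutator_set A) (circ_group A)"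
proof (rule circ.subgroupI)
  show "brace_commutator_set A \<subseteq> carrier (circ_group A)" by auto
  show "brace_commutator_set A \<noteq> {}" using comm_closed(2) by blast
  show "inv\<^bsub>circ_group A\<^esub> x \<in> brace_commutator_set A" if x: "x \<in> brace_commutator_set A" for x
  proof -
    let ?w = "inv\<^bsub>circ_group A\<^esub> x"
    have xc: "x \<in> carrier A" using x by simp
    \<comment> \<open>Rewriting the circle product of \<open>?w\<close> and \<open>x\<close> through
      \<lambda> exhibits the circle inverse as a multiplicative inverse of a \<lambda>-image of
      \<open>x\<close>, and \<lambda> preserves A'.\<close>
    have "?w \<otimes> brace_lambda A ?w x = \<one>"
      using circ.l_inv[of x] xc circ_eq_lambda[of ?w x] by simp
    then have "?w = inv (brace_lambda A ?w x)"
      using xc by (metis circ_inv_closed inv_equality inv_inv lambda_closed)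
    then show ?thesis using lambda_in[of ?w x] x xc by (metis circ_inv_closed comm_closed(4))
  qed
  show "x \<otimes>\<^bsub>circ_group A\<^esub> y \<in> brace_commutator_set A"
    if "x \<in> brace_commutator_set A" "y \<in> brace_commutator_set A" for x y
    using that by (simp add: circ_eq_lambda lambda_in)
qed

text \<open>Expand the circle product of a and b as a (a * b) b, likewise with a and b exchanged,
  and telescope. Every bracketed factor on the right lies in A', although a and b need not.\<close>

lemma circ_mult_inv_swap:
  assumes "a \<in> carrier A" "b \<in> carrier A"
  shows "(a \<star> b) \<otimes> inv (b \<star> a)
    = (a \<otimes> lambda_star A a b \<otimes> inv a) \<otimes> commutator A a b \<otimes> (b \<otimes> inv (lambda_star A b a) \<otimes> inv b)"
  using assms
  by (simp add: circ_eq_lambda lambda_eq_lambda_star_mult commutator_def inv_mult_group m_assoc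
      inv_mult_cancel)

text \<open>Put y = \<open>b \<star> a\<close>. Then c circ y is \<open>a \<star> b\<close>, while c
  circ y = c (c * y) y by the definition of *; multiply by y^-1 on the right.\<close>

lemma circ_commutator_mult_lambda_star:
  assumes a: "a \<in> carrier A" and b: "b \<in> carrier A"
  defines "c \<equiv> commutator (circ_group A) a b"
  shows "c \<otimes> lambda_star A c (b \<star> a) = (a \<star> b) \<otimes> inv (b \<star> a)"
proof -
  have "c \<in> carrier A" using a b circ.commutator_closed[of a b] by (simp add: c_def)
  moreover have "c \<star> (b \<star> a) = a \<star> b"
    using circ.commutator_mult_swap[of a b] a b by (simp add: c_def)
  ultimately show ?thesis
    using a b circ_eq_lambda[of c "b \<star> a"] by (simp add: lambda_star_def m_assoc[symmetric])
qed

text \<open>Needed for \<open>\<xi>2\<close> to be meaningful on circle commutators. The two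
  preceding identities put c (c * y) in A', and the factor c * y is itself there.\<close>

lemma circ_commutator_in:
  assumes a: "a \<in> carrier A" and b: "b \<in> carrier A"
  shows "commutator (circ_group A) a b \<in> brace_commutator_set A"
proof -
  define c where "c = commutator (circ_group A) a b"
  have c: "c \<in> carrier A" using a b circ.commutator_closed[of a b] by (simp add: c_def)
  have "c \<otimes> lambda_star A c (b \<star> a) \<in> brace_commutator_set A"
    unfolding c_def circ_commutator_mult_lambda_star[OF a b] circ_mult_inv_swap[OF a b]
    using a b by (simp add: conj_in)
  then have "c \<otimes> lambda_star A c (b \<star> a) \<otimes> inv (lambda_star A c (b \<star> a)) \<in> brace_commutator_set A"
    using a b c by simp
  then show ?thesis using a b c by (simp add: c_def[symmetric] cancel_right)
qed

lemma circ_derived_subset: "derived (circ_group A) (carrier A) \<subseteq> brace_commutator_set A"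
proof -
  have "commutators (circ_group A) \<subseteq> brace_commutator_set A"
    by (auto simp: commutators_def circ_commutator_in)
  from circ.generate_subgroup_incl[OF this brace_commutator_circ_subgroup] show ?thesis
    using derived_eq_generate_commutators[of "circ_group A"] by simp
qed

section \<open>The quotient by the annihilator as a pair of factor groups\<close>

lemma annihilator_circ_coset:
  assumes "a \<in> carrier A"
  shows "annihilator A #>\<^bsub>circ_group A\<^esub> a = annihilator A #> a"
  using assms annihilatorD(5) by (auto simp: r_coset_def)

lemma carrier_brace_quotient:
  "carrier (brace_quotient A (annihilator A)) = (\<lambda>a. annihilator A #> a) ` carrier A"
  by (auto simp: brace_quotient_def RCOSETS_def)

text \<open>Annihilator elements multiply identically in both groups, so both have the same cosets.
  The circle part of the quotient is therefore an ordinary factor group, whose carrier was given by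
  cosets of the other group.\<close>

lemma circ_group_brace_quotient:
  "circ_group (brace_quotient A (annihilator A)) = circ_group A Mod annihilator A"
  unfolding circ_group_def[of "brace_quotient A (annihilator A)"]
  by (simp add: brace_quotient_def FactGroup_def RCOSETS_def annihilator_circ_coset)

lemma annihilator_normal: "annihilator A \<lhd> A" "annihilator A \<lhd> circ_group A"
  using annihilator_ideal by (simp_all add: brace_ideal_def)

lemma circ_coset_hom:
  "(\<lambda>a. annihilator A #> a) \<in> hom (circ_group A) (circ_group A Mod annihilator A)"
proof -
  have "(\<lambda>a. annihilator A #>\<^bsub>circ_group A\<^esub> a)
      \<in> hom (circ_group A) (circ_group A Mod annihilator A)"
    by (rule normal.r_coset_hom_Mod[OF annihilator_normal(2)])
  then show ?thesis
    by (simp add: hom_def annihilator_circ_coset Pi_iff)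
qed

end

section \<open>Isoclinic skew left braces\<close>

lemma hom_brace_quotient:
  "hom (brace_quotient A I) (brace_quotient B J) = hom (A Mod I) (B Mod J)"
  by (simp add: hom_def brace_quotient_def FactGroup_def)

locale brace_isoclinism = A: skew_left_brace A + B: skew_left_brace B
  for A :: "('a, 'm) skew_brace_scheme" and B :: "('b, 'n) skew_brace_scheme"
    and \<xi>1 :: "'a set \<Rightarrow> 'b set" and \<xi>2 :: "'a \<Rightarrow> 'b" +
  assumes xi1: "\<xi>1 \<in> brace_iso (brace_quotient A (annihilator A)) (brace_quotient B (annihilator B))"
    and xi2: "\<xi>2 \<in> brace_iso (brace_commutator A) (brace_commutator B)"
    and xi2_theta:
      "\<lbrakk>X \<in> carrier (brace_quotient A (annihilator A)); Y \<in> carrier (brace_quotient A (annihilator A))\<rbrakk>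
        \<Longrightarrow> \<xi>2 (theta A X Y) = theta B (\<xi>1 X) (\<xi>1 Y)"
    and xi2_theta_star:
      "\<lbrakk>X \<in> carrier (brace_quotient A (annihilator A)); Y \<in> carrier (brace_quotient A (annihilator A))\<rbrakk>
        \<Longrightarrow> \<xi>2 (theta_star A X Y) = theta_star B (\<xi>1 X) (\<xi>1 Y)"
begin

section \<open>Corresponding representatives under the isomorphism of the quotients\<close>

text \<open>A relation on elements replaces the map \<open>\<xi>1\<close> on cosets, so no
  representatives have to be chosen. It is total on both sides and compatible with both brace
  operations.\<close>

definition corr :: "'a \<Rightarrow> 'b \<Rightarrow> bool" where
  "corr a b \<longleftrightarrow> a \<in> carrier A \<and> b \<in> carrier B \<and>
     \<xi>1 (annihilator A #>\<^bsub>A\<^esub> a) = annihilator B #>\<^bsub>B\<^esub> b"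

lemma corr_carrier:
  assumes "corr a b"
  shows "a \<in> carrier A" "b \<in> carrier B"
  using assms by (simp_all add: corr_def)

lemma xi1_bij: "bij_betw \<xi>1 ((\<lambda>a. annihilator A #>\<^bsub>A\<^esub> a) ` carrier A)
    ((\<lambda>b. annihilator B #>\<^bsub>B\<^esub> b) ` carrier B)"
  using xi1 by (simp add: brace_iso_def iso_def A.carrier_brace_quotient B.carrier_brace_quotient)

lemma corr_left_total: "a \<in> carrier A \<Longrightarrow> \<exists>b. corr a b"
  using bij_betwE[OF xi1_bij] unfolding corr_def by blast

lemma corr_right_total: "b \<in> carrier B \<Longrightarrow> \<exists>a. corr a b"
  using bij_betw_imp_surj_on[OF xi1_bij] unfolding corr_def by (metis (no_types, lifting) imageE imageI)

text \<open>For each operation, \<open>corr\<close> holds where two homomorphisms into the same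
  quotient of \<open>B\<close> agree. It is thus a fibre product, which yields its closure under
  products and inverses.\<close>

lemma corr_homs:
  shows "group_hom A (B Mod annihilator B) (\<lambda>a. \<xi>1 (annihilator A #>\<^bsub>A\<^esub> a))"
    and "group_hom B (B Mod annihilator B) (\<lambda>b. annihilator B #>\<^bsub>B\<^esub> b)"
    and "group_hom (circ_group A) (circ_group B Mod annihilator B)
      (\<lambda>a. \<xi>1 (annihilator A #>\<^bsub>A\<^esub> a))"
    and "group_hom (circ_group B) (circ_group B Mod annihilator B)
      (\<lambda>b. annihilator B #>\<^bsub>B\<^esub> b)"
proof -
  have xi1_hom: "\<xi>1 \<in> hom (A Mod annihilator A) (B Mod annihilator B)"
    "\<xi>1 \<in> hom (circ_group A Mod annihilator A) (circ_group B Mod annihilator B)"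
    using xi1 by (auto simp: brace_iso_def iso_def hom_brace_quotient
        A.circ_group_brace_quotient B.circ_group_brace_quotient)
  note hom_A = normal.r_coset_hom_Mod[OF A.annihilator_normal(1)]
    and hom_B = normal.r_coset_hom_Mod[OF B.annihilator_normal(1)]
    and groups = normal.factorgroup_is_group[OF B.annihilator_normal(1)]
      normal.factorgroup_is_group[OF B.annihilator_normal(2)]
  show "group_hom A (B Mod annihilator B) (\<lambda>a. \<xi>1 (annihilator A #>\<^bsub>A\<^esub> a))"
    using hom_compose[OF hom_A xi1_hom(1)] groups A.is_group
    by (simp add: group_hom_def group_hom_axioms_def comp_def)
  show "group_hom B (B Mod annihilator B) (\<lambda>b. annihilator B #>\<^bsub>B\<^esub> b)"
    using hom_B groups B.is_group by (simp add: group_hom_def group_hom_axioms_def)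
  show "group_hom (circ_group A) (circ_group B Mod annihilator B) (\<lambda>a. \<xi>1 (annihilator A #>\<^bsub>A\<^esub> a))"
    using hom_compose[OF A.circ_coset_hom xi1_hom(2)] groups A.circ.is_group
    by (simp add: group_hom_def group_hom_axioms_def comp_def)
  show "group_hom (circ_group B) (circ_group B Mod annihilator B) (\<lambda>b. annihilator B #>\<^bsub>B\<^esub> b)"
    using B.circ_coset_hom groups B.circ.is_group
    by (simp add: group_hom_def group_hom_axioms_def)
qed

lemma corr_one: "corr \<one>\<^bsub>A\<^esub> \<one>\<^bsub>B\<^esub>"
  unfolding corr_def
  using group_hom.hom_one[OF corr_homs(1)] group_hom.hom_one[OF corr_homs(2)] by simp

lemma corr_mult:
  assumes "corr a a'" "corr b b'"
  shows "corr (a \<otimes>\<^bsub>A\<^esub> b) (a' \<otimes>\<^bsub>B\<^esub> b')"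
  using assms group_hom.hom_mult[OF corr_homs(1), of a b] group_hom.hom_mult[OF corr_homs(2), of a' b']
  by (simp add: corr_def)

lemma corr_inv:
  assumes "corr a a'"
  shows "corr (inv\<^bsub>A\<^esub> a) (inv\<^bsub>B\<^esub> a')"
  using assms group_hom.hom_inv[OF corr_homs(1), of a] group_hom.hom_inv[OF corr_homs(2), of a']
  by (simp add: corr_def)

lemma corr_circ:
  assumes "corr a a'" "corr b b'"
  shows "corr (a \<star>\<^bsub>A\<^esub> b) (a' \<star>\<^bsub>B\<^esub> b')"
  using assms group_hom.hom_mult[OF corr_homs(3), of a b] group_hom.hom_mult[OF corr_homs(4), of a' b']
  by (simp add: corr_def)

lemma corr_circ_inv:
  assumes "corr a a'"
  shows "corr (inv\<^bsub>circ_group A\<^esub> a) (inv\<^bsub>circ_group B\<^esub> a')"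
  using assms group_hom.hom_inv[OF corr_homs(3), of a] group_hom.hom_inv[OF corr_homs(4), of a']
  by (simp add: corr_def)

lemma corr_commutator:
  assumes "corr a a'" "corr b b'"
  shows "corr (commutator A a b) (commutator B a' b')"
  unfolding commutator_def by (intro corr_mult corr_inv assms)

lemma corr_circ_commutator:
  assumes "corr a a'" "corr b b'"
  shows "corr (commutator (circ_group A) a b) (commutator (circ_group B) a' b')"
  unfolding commutator_def A.circ_group_simps B.circ_group_simps
  by (intro corr_circ corr_circ_inv assms)

lemma corr_lambda_star:
  assumes "corr a a'" "corr b b'"
  shows "corr (lambda_star A a b) (lambda_star B a' b')"
proof -
  have "corr (inv\<^bsub>A\<^esub> a \<otimes>\<^bsub>A\<^esub> (a \<star>\<^bsub>A\<^esub> b) \<otimes>\<^bsub>A\<^esub> inv\<^bsub>A\<^esub> b)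
      (inv\<^bsub>B\<^esub> a' \<otimes>\<^bsub>B\<^esub> (a' \<star>\<^bsub>B\<^esub> b') \<otimes>\<^bsub>B\<^esub> inv\<^bsub>B\<^esub> b')"
    by (intro corr_mult corr_inv corr_circ assms)
  then show ?thesis
    using corr_carrier[OF assms(2)] by (simp add: lambda_star_def brace_lambda_def)
qed

section \<open>The isomorphism of the brace commutators on representatives\<close>

lemma xi2_commutator:
  assumes "corr a a'" "corr b b'"
  shows "\<xi>2 (commutator A a b) = commutator B a' b'"
  using assms xi2_theta[of "annihilator A #>\<^bsub>A\<^esub> a" "annihilator A #>\<^bsub>A\<^esub> b"]
  by (auto simp: corr_def A.carrier_brace_quotient A.theta_coset B.theta_coset commutator_def)

lemma xi2_lambda_star:
  assumes "corr a a'" "corr b b'"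
  shows "\<xi>2 (lambda_star A a b) = lambda_star B a' b'"
  using assms xi2_theta_star[of "annihilator A #>\<^bsub>A\<^esub> a" "annihilator A #>\<^bsub>A\<^esub> b"]
  by (auto simp: corr_def A.carrier_brace_quotient A.theta_star_coset B.theta_star_coset
      lambda_star_def)

lemma xi2_bij: "bij_betw \<xi>2 (brace_commutator_set A) (brace_commutator_set B)"
  using xi2 by (simp add: brace_iso_def iso_def brace_commutator_def)

lemma xi2_closed: "x \<in> brace_commutator_set A \<Longrightarrow> \<xi>2 x \<in> brace_commutator_set B"
  using bij_betwE[OF xi2_bij] by blast

lemma xi2_mult:
  "\<lbrakk>x \<in> brace_commutator_set A; y \<in> brace_commutator_set A\<rbrakk>
    \<Longrightarrow> \<xi>2 (x \<otimes>\<^bsub>A\<^esub> y) = \<xi>2 x \<otimes>\<^bsub>B\<^esub> \<xi>2 y"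
  using xi2 by (simp add: brace_iso_def iso_def hom_def brace_commutator_def)

lemma xi2_circ:
  "\<lbrakk>x \<in> brace_commutator_set A; y \<in> brace_commutator_set A\<rbrakk>
    \<Longrightarrow> \<xi>2 (x \<star>\<^bsub>A\<^esub> y) = \<xi>2 x \<star>\<^bsub>B\<^esub> \<xi>2 y"
  using xi2 by (simp add: brace_iso_def iso_def hom_def brace_commutator_def circ_group_def)

lemma xi2_one: "\<xi>2 \<one>\<^bsub>A\<^esub> = \<one>\<^bsub>B\<^esub>"
  using xi2_mult[of "\<one>\<^bsub>A\<^esub>" "\<one>\<^bsub>A\<^esub>"] xi2_closed[of "\<one>\<^bsub>A\<^esub>"] by simp

lemma xi2_inv:
  assumes x: "x \<in> brace_commutator_set A"
  shows "\<xi>2 (inv\<^bsub>A\<^esub> x) = inv\<^bsub>B\<^esub> \<xi>2 x"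
proof -
  have "\<xi>2 (inv\<^bsub>A\<^esub> x) \<otimes>\<^bsub>B\<^esub> \<xi>2 x = \<one>\<^bsub>B\<^esub>"
    using x xi2_mult[of "inv\<^bsub>A\<^esub> x" x] by (simp add: xi2_one)
  then show ?thesis
    using x by (intro B.inv_equality[symmetric]) (simp_all add: xi2_closed)
qed

text \<open>On a generator, \<open>\<xi>2\<close> replaces the arguments by corresponding ones, and
  the result corresponds to the generator because \<open>corr\<close> respects the operations.
  Induction over generation extends this to A', linking \<open>\<xi>2\<close> with
  \<open>\<xi>1\<close>.\<close>

lemma corr_xi2:
  assumes "x \<in> brace_commutator_set A"
  shows "corr x (\<xi>2 x)"
proof -
  have incl: "corr x (\<xi>2 x)" if "x \<in> A.star_gens" for x
  proof -
    consider (comm) a b where "a \<in> carrier A" "b \<in> carrier A" "x = commutator A a b"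
      | (star) a b where "a \<in> carrier A" "b \<in> carrier A" "x = lambda_star A a b"
      using \<open>x \<in> A.star_gens\<close> unfolding A.star_gens_def commutators_def by blast
    then show ?thesis
      by cases (metis corr_left_total corr_commutator corr_lambda_star xi2_commutator xi2_lambda_star)+
  qed
  show ?thesis
    using assms unfolding A.brace_commutator_set_eq_star_gens
  proof (induction rule: generate.induct)
    case one
    then show ?case by (simp add: xi2_one corr_one)
  next
    case (incl h)
    then show ?case by (rule \<open>\<And>x. x \<in> A.star_gens \<Longrightarrow> corr x (\<xi>2 x)\<close>)
  next
    case (inv h)
    then have "h \<in> brace_commutator_set A"
      by (simp add: A.brace_commutator_set_eq_star_gens generate.incl)
    then show ?case using corr_inv[OF incl[OF inv]] by (simp add: xi2_inv)
  next
    case (eng g h)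
    then show ?case
      using corr_mult[OF eng.IH] xi2_mult[of g h] by (simp add: A.brace_commutator_set_eq_star_gens)
  qed
qed

text \<open>Write a x a^-1 as [a, x] x. Since x corresponds to \<open>\<xi>2 x\<close> by
  \<open>corr_xi2\<close>, compatibility with \<open>theta\<close> sends [a, x] to the commutator of
  a' and \<open>\<xi>2 x\<close>.\<close>

lemma xi2_conj:
  assumes "corr a a'" and x: "x \<in> brace_commutator_set A"
  shows "\<xi>2 (a \<otimes>\<^bsub>A\<^esub> x \<otimes>\<^bsub>A\<^esub> inv\<^bsub>A\<^esub> a) = a' \<otimes>\<^bsub>B\<^esub> \<xi>2 x \<otimes>\<^bsub>B\<^esub> inv\<^bsub>B\<^esub> a'"
  using corr_carrier[OF assms(1)] xi2_closed[OF x] xi2_commutator[OF assms(1) corr_xi2[OF x]] x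
  by (simp add: A.conj_eq_commutator_mult B.conj_eq_commutator_mult xi2_mult)

lemma xi2_circ_mult_inv_swap:
  assumes a: "corr a a'" and b: "corr b b'"
  shows "\<xi>2 ((a \<star>\<^bsub>A\<^esub> b) \<otimes>\<^bsub>A\<^esub> inv\<^bsub>A\<^esub> (b \<star>\<^bsub>A\<^esub> a)) = (a' \<star>\<^bsub>B\<^esub> b') \<otimes>\<^bsub>B\<^esub> inv\<^bsub>B\<^esub> (b' \<star>\<^bsub>B\<^esub> a')"
  using corr_carrier[OF a] corr_carrier[OF b]
  by (simp add: A.circ_mult_inv_swap B.circ_mult_inv_swap xi2_mult A.conj_in xi2_conj[OF a]
      xi2_conj[OF b] xi2_inv xi2_commutator[OF a b] xi2_lambda_star[OF a b] xi2_lambda_star[OF b a])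

text \<open>The homomorphism property of \<open>\<xi>2\<close> cannot be applied to \<open>a\<close>
  and \<open>b\<close>, which may lie outside A'. The commutator is instead recovered from the
  multiplicative identity for c (c * y), whose terms \<open>\<xi>2\<close> transports.\<close>

lemma xi2_circ_commutator:
  assumes a: "corr a a'" and b: "corr b b'"
  shows "\<xi>2 (commutator (circ_group A) a b) = commutator (circ_group B) a' b'"
proof -
  define c c' where "c = commutator (circ_group A) a b" and "c' = commutator (circ_group B) a' b'"
  note carr = corr_carrier[OF a] corr_carrier[OF b]
  have c: "c \<in> brace_commutator_set A" "c' \<in> brace_commutator_set B"
    unfolding c_def c'_def by (intro A.circ_commutator_in B.circ_commutator_in carr)+
  \<comment> \<open>The commutators \<open>c\<close> and \<open>c'\<close> correspond because
    \<open>corr\<close> respects the circle operations, so compatibility with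
    \<open>theta_star\<close> applies to them as arguments.\<close>
  have star: "\<xi>2 (lambda_star A c (b \<star>\<^bsub>A\<^esub> a)) = lambda_star B c' (b' \<star>\<^bsub>B\<^esub> a')"
    unfolding c_def c'_def by (intro xi2_lambda_star corr_circ_commutator corr_circ a b)
  have "\<xi>2 c \<otimes>\<^bsub>B\<^esub> lambda_star B c' (b' \<star>\<^bsub>B\<^esub> a') = \<xi>2 (c \<otimes>\<^bsub>A\<^esub> lambda_star A c (b \<star>\<^bsub>A\<^esub> a))"
    using c carr by (simp add: xi2_mult star)
  also have "\<dots> = c' \<otimes>\<^bsub>B\<^esub> lambda_star B c' (b' \<star>\<^bsub>B\<^esub> a')"
    using carr
    by (simp add: c_def c'_def A.circ_commutator_mult_lambda_star B.circ_commutator_mult_lambda_star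
        xi2_circ_mult_inv_swap[OF a b])
  finally have "\<xi>2 c = c'" using c carr xi2_closed[OF c(1)] by simp
  then show ?thesis by (simp add: c_def c'_def)
qed

lemma xi2_image_circ_derived:
  "\<xi>2 ` derived (circ_group A) (carrier A) = derived (circ_group B) (carrier B)"
proof -
  \<comment> \<open>\<open>\<xi>2\<close> is a homomorphism only on A', so generation is carried out
    in the circle group on A'; \<open>generate_consistent\<close> returns to the full circle
    group.\<close>
  let ?C = "(circ_group A)\<lparr>carrier := brace_commutator_set A\<rparr>"
  have sub: "commutators (circ_group A) \<subseteq> brace_commutator_set A"
    by (auto simp: commutators_def A.circ_commutator_in)
  have "group ?C"
    by (rule A.circ.subgroup_imp_group[OF A.brace_commutator_circ_subgroup])
  then have hom: "group_hom ?C (circ_group B) \<xi>2"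
    using B.circ.is_group xi2_closed
    by (auto simp: group_hom_def group_hom_axioms_def hom_def xi2_circ)
  have img: "\<xi>2 ` commutators (circ_group A) = commutators (circ_group B)"
  proof (intro equalityI subsetI)
    fix y assume "y \<in> \<xi>2 ` commutators (circ_group A)"
    then obtain a b where ab: "a \<in> carrier A" "b \<in> carrier A" "y = \<xi>2 (commutator (circ_group A) a b)"
      by (auto simp: commutators_def)
    moreover obtain a' b' where "corr a a'" "corr b b'"
      using ab corr_left_total by blast
    ultimately show "y \<in> commutators (circ_group B)"
      using corr_carrier xi2_circ_commutator by (auto intro!: commutatorsI)
  next
    fix y assume "y \<in> commutators (circ_group B)"
    then obtain a' b' where ab: "a' \<in> carrier B" "b' \<in> carrier B" "y = commutator (circ_group B) a' b'"
      by (auto simp: commutators_def)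
    \<comment> \<open>Surjectivity on commutators uses preimages under \<open>corr\<close>, since
      \<open>a'\<close> and \<open>b'\<close> need not lie in the range of
      \<open>\<xi>2\<close>.\<close>
    then obtain a b where "corr a a'" "corr b b'" using corr_right_total by blast
    then show "y \<in> \<xi>2 ` commutators (circ_group A)"
      using ab corr_carrier xi2_circ_commutator
      by (intro image_eqI[of _ _ "commutator (circ_group A) a b"] commutatorsI) auto
  qed
  have "\<xi>2 ` generate ?C (commutators (circ_group A)) = generate (circ_group B) (\<xi>2 ` commutators (circ_group A))"
    using group_hom.generate_img[OF hom] sub by simp
  then have "\<xi>2 ` generate (circ_group A) (commutators (circ_group A)) = generate (circ_group B) (commutators (circ_group B))"
    using A.circ.generate_consistent[OF sub A.brace_commutator_circ_subgroup] by (simp add: img)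
  then show ?thesis
    using derived_eq_generate_commutators[of "circ_group A"]
      derived_eq_generate_commutators[of "circ_group B"] by simp
qed

theorem commutator_group_iso:
  "(\<lambda>(x, c). (\<xi>2 x, \<xi>2 c))
    \<in> iso (commutator_group (Lambda_op A)) (commutator_group (Lambda_op B))"
proof (rule isoI)
  note subset = subsetD[OF A.circ_derived_subset]
  have carrier: "carrier (commutator_group (Lambda_op A))
      = brace_commutator_set A \<times> derived (circ_group A) (carrier A)"
    "carrier (commutator_group (Lambda_op B))
      = brace_commutator_set B \<times> derived (circ_group B) (carrier B)"
    by (simp_all add: commutator_group_def A.derived_Lambda_op B.derived_Lambda_op)
  have mult: "(x, c) \<otimes>\<^bsub>commutator_group (Lambda_op A)\<^esub> (y, d)
      = (x \<otimes>\<^bsub>A\<^esub> brace_lambda_op A c y, c \<star>\<^bsub>A\<^esub> d)"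
    "(x', c') \<otimes>\<^bsub>commutator_group (Lambda_op B)\<^esub> (y', d')
      = (x' \<otimes>\<^bsub>B\<^esub> brace_lambda_op B c' y', c' \<star>\<^bsub>B\<^esub> d')" for x c y d x' c' y' d'
    by (simp_all add: commutator_group_def Lambda_op_def semidirect_product_def)
  have bij: "bij_betw \<xi>2 (derived (circ_group A) (carrier A)) (derived (circ_group B) (carrier B))"
    by (rule bij_betw_subset[OF xi2_bij A.circ_derived_subset xi2_image_circ_derived])
  \<comment> \<open>For arguments in A', the opposite action (c circ x) c^-1 uses only operations of
    the brace A', so \<open>\<xi>2\<close> respects it. The acting components qualify because the
    circle derived subgroup lies in A'.\<close>
  have op: "brace_lambda_op A c x \<in> brace_commutator_set A"
    "\<xi>2 (brace_lambda_op A c x) = brace_lambda_op B (\<xi>2 c) (\<xi>2 x)"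
    if "x \<in> brace_commutator_set A" "c \<in> brace_commutator_set A" for x c
    using that subgroup.m_closed[OF A.brace_commutator_circ_subgroup, of c x]
    by (simp_all add: brace_lambda_op_def xi2_mult xi2_circ xi2_inv xi2_closed)
  show "(\<lambda>(x, c). (\<xi>2 x, \<xi>2 c))
      \<in> hom (commutator_group (Lambda_op A)) (commutator_group (Lambda_op B))"
  proof (rule homI)
    fix p assume "p \<in> carrier (commutator_group (Lambda_op A))"
    then show "(case p of (x, c) \<Rightarrow> (\<xi>2 x, \<xi>2 c)) \<in> carrier (commutator_group (Lambda_op B))"
      using xi2_closed bij_betwE[OF bij] by (auto simp: carrier)
  next
    fix p q
    assume "p \<in> carrier (commutator_group (Lambda_op A))" "q \<in> carrier (commutator_group (Lambda_op A))"
    then show "(case p \<otimes>\<^bsub>commutator_group (Lambda_op A)\<^esub> q of (x, c) \<Rightarrow> (\<xi>2 x, \<xi>2 c))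
      = (case p of (x, c) \<Rightarrow> (\<xi>2 x, \<xi>2 c)) \<otimes>\<^bsub>commutator_group (Lambda_op B)\<^esub>
        (case q of (x, c) \<Rightarrow> (\<xi>2 x, \<xi>2 c))"
      using subset
      by (auto simp: carrier mult op xi2_mult xi2_circ)
  qed
  show "bij_betw (\<lambda>(x, c). (\<xi>2 x, \<xi>2 c)) (carrier (commutator_group (Lambda_op A)))
      (carrier (commutator_group (Lambda_op B)))"
    unfolding carrier using xi2_bij bij by (rule bij_betw_map_prod[unfolded map_prod_def])
qed

end

theorem theorem3p13:
  fixes A :: "'a skew_brace" and B :: "'b skew_brace"
  assumes "skew_left_brace A" and "skew_left_brace B"
    and "isoclinic A B"
  shows "commutator_group (Lambda_op A) \<cong> commutator_group (Lambda_op B)"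
proof -
  from assms(3) obtain \<xi>1 \<xi>2 where "brace_isoclinism A B \<xi>1 \<xi>2"
    using assms(1,2)
    by (auto simp: isoclinic_def brace_isoclinism_def brace_isoclinism_axioms_def)
  then show ?thesis
    by (rule is_isoI[OF brace_isoclinism.commutator_group_iso])
qed

end
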